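(* Let $a,b\in\mathbb{C}$ be such that $n^2-an-b^2\neq 0$ for every integer $n\geqslant 1$. Then $$\prod_{k=1}^{\infty}\begin{bmatrix}\frac{k}{2(2k+1)}\,\frac{k^{2}-a^{2}-4b^{2}}{k^{2}-ak-b^{2}} & \frac{3k-a}{k^{2}-ak-b^{2}}\\ 0 & 1\end{bmatrix}=\begin{bmatrix}0 & \displaystyle\sum_{n\geqslant1}\frac{2}{n^{2}-an-b^{2}}\\ 0 & 1\end{bmatrix}.$$ Moreover, if $a^2+4b^2\neq 0$, then $$\sum_{n\geqslant1}\frac{2}{n^{2}-an-b^{2}}=\frac{2}{\sqrt{a^{2}+4b^{2}}}\left[\psi\left(1-\frac{a}{2}+\frac{\sqrt{a^{2}+4b^{2}}}{2}\right)-\psi\left(1-\frac{a}{2}-\frac{\sqrt{a^{2}+4b^{2}}}{2}\right)\right].$$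
   Context: $\psi=\Gamma'/\Gamma$ is the digamma function; $\sqrt{a^2+4b^2}$ denotes a fixed square root (the expression does not depend on the choice). The infinite product $\prod_{k=1}^\infty \mathbf{M}_k$ of square matrices means the entrywise limit as $m\to\infty$ of the ordered products $\mathbf{M}_1\mathbf{M}_2\cdots\mathbf{M}_m$ (factors multiplied from left to right in increasing index). *)

theory Defs
  imports "HOL-Analysis.Analysis"
begin

text \<open>Matrix multiplication is not the multiplication of a type-class monoid on
  \<^typ>\<open>'a^'n^'n\<close>, so the ordered product $M_1 M_2 \cdots M_m$ is given by recursion.
  New factors are appended on the right, and the index starts at 1.\<close>

primrec matrix_partial_prod :: "(nat \<Rightarrow> 'a::comm_ring_1 ^ 'n ^ 'n) \<Rightarrow> nat \<Rightarrow> 'a ^ 'n ^ 'n" where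
  "matrix_partial_prod M 0 = mat 1"
| "matrix_partial_prod M (Suc m) = matrix_partial_prod M m ** M (Suc m)"

definition has_matrix_prod ::
    "(nat \<Rightarrow> 'a::{comm_ring_1, topological_space} ^ 'n ^ 'n) \<Rightarrow> 'a ^ 'n ^ 'n \<Rightarrow> bool"
    (infix "has'_matrix'_prod" 80) where
  "M has_matrix_prod L \<longleftrightarrow>
     (\<forall>i j. (\<lambda>m. matrix_partial_prod M m $ i $ j) \<longlonglongrightarrow> L $ i $ j)"

text \<open>The library defines \<^const>\<open>Polygamma\<close>, and hence the digamma function, by a series.\<close>

lemma Digamma_eq_logderiv_Gamma:
  fixes z :: complex
  assumes "z \<notin> \<int>\<^sub>\<le>\<^sub>0"
  shows "Digamma z = deriv Gamma z / Gamma z"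
proof -
  have "(Gamma has_field_derivative Gamma z * Digamma z) (at z)"
    using assms by (rule has_field_derivative_Gamma)
  then have "deriv Gamma z = Gamma z * Digamma z"
    by (rule DERIV_imp_deriv)
  moreover have "Gamma z \<noteq> 0"
    using assms by (simp add: Gamma_eq_zero_iff)
  ultimately show ?thesis by simp
qed

end

theory Submission
  imports Defs "HOL-Real_Asymp.Real_Asymp"
begin

text \<open>Write \<open>q x = x\<^sup>2 - a x - b\<^sup>2\<close> and \<open>D = a\<^sup>2 + 4 b\<^sup>2\<close>. The terms
  \<open>F m n = \<kappa>\<^sub>m / (q (n + 1) \<cdots> q (n + m + 1))\<close> with \<open>\<kappa>\<^sub>0 = 2\<close> and
  \<open>\<kappa>\<^sub>m\<^sub>+\<^sub>1 = \<kappa>\<^sub>m (m + 1) ((m + 1)\<^sup>2 - D) / (2 (2 m + 1))\<close> and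
  \<open>G m n = F m n (3 m + 3 - a + 2 n) / (2 (2 m + 1))\<close> form a WZ pair:
  \<open>F m n - F (m + 1) n = G m n - G m (n + 1)\<close>. The upper right entry of the \<open>m\<close>-th partial
  product is the sum of the \<open>G k 0\<close> with \<open>k < m\<close>, which therefore differs from the sum of the
  \<open>F 0 n = 2 / q (n + 1)\<close> by the sum over \<open>n\<close> of the \<open>F m n\<close>. The latter decays geometrically in
  \<open>m\<close>, since eventually \<open>\<bar>F (m + 1) n\<bar> \<le> \<bar>F m n\<bar> / 2\<close> uniformly in \<open>n\<close>. Partial fractions turn
  the series into a difference of digamma values.\<close>

section \<open>The WZ pair and its polynomial certificate\<close>

locale matrix_wz =
  fixes a b :: complex
  assumes nonzero: "\<And>n::nat. n \<ge> 1 \<Longrightarrow> (of_nat n)\<^sup>2 - a * of_nat n - b\<^sup>2 \<noteq> 0"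
begin

definition q :: "nat \<Rightarrow> complex" where
  "q n = (of_nat n)\<^sup>2 - a * of_nat n - b\<^sup>2"

primrec F :: "nat \<Rightarrow> nat \<Rightarrow> complex" where
  "F 0 n = 2 / q (Suc n)"
| "F (Suc m) n = F m n * (of_nat (Suc m) * ((of_nat (Suc m))\<^sup>2 - a\<^sup>2 - 4 * b\<^sup>2))
     / (2 * of_nat (2 * m + 1) * q (n + m + 2))"

definition G :: "nat \<Rightarrow> nat \<Rightarrow> complex" where
  "G m n = F m n * (3 * of_nat (Suc m) - a + 2 * of_nat n) / (2 * of_nat (2 * m + 1))"

definition diag :: "nat \<Rightarrow> complex" where
  "diag k = of_nat k / (2 * (2 * of_nat k + 1)) * (((of_nat k)\<^sup>2 - a\<^sup>2 - 4 * b\<^sup>2) / q k)"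

lemma q_nonzero: "q (Suc n) \<noteq> 0"
  using nonzero[of "Suc n"] by (simp add: q_def)

text \<open>\<open>F m n\<close> is a constant depending on \<open>m\<close> over a window of
  \<open>m + 1\<close> consecutive values of \<open>q\<close>; moving the window by one exchanges
  its end factors.\<close>

lemma F_shift: "F m (Suc n) * q (n + m + 2) = F m n * q (Suc n)"
proof (induction m)
  case 0
  show ?case using q_nonzero[of n] q_nonzero[of "Suc n"] by simp
next
  case (Suc m)
  have "F m (Suc n) = F m n * q (Suc n) / q (n + m + 2)"
    using Suc q_nonzero[of "n + m + 1"] by (simp add: field_simps)
  then show ?case
    using q_nonzero[of "n + m + 1"] q_nonzero[of "n + m + 2"]
    by (simp add: mult_ac del: of_nat_Suc)
qed

lemma F_diff: "F m n - F (Suc m) n = G m n - G m (Suc n)"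
proof -
  define x y z w where "x = (of_nat m :: complex)" and "y = (of_nat n :: complex)"
    and "z = q (n + m + 2)" and "w = (2 * of_nat (2 * m + 1) :: complex)"
  define c e e' where "c = (x + 1) * ((x + 1)\<^sup>2 - a\<^sup>2 - 4 * b\<^sup>2)"
    and "e = 3 * (x + 1) - a + 2 * y" and "e' = 3 * (x + 1) - a + 2 * (y + 1)"
  have z0: "z \<noteq> 0" using q_nonzero[of "n + m + 1"] by (simp add: z_def)
  have w0: "w \<noteq> 0" by (simp only: w_def mult_eq_0_iff of_nat_eq_0_iff) simp
  have p: "q (Suc n) = (y + 1)\<^sup>2 - a * (y + 1) - b\<^sup>2"
    by (simp add: q_def y_def add.commute)
  have z: "z = (y + x + 2)\<^sup>2 - a * (y + x + 2) - b\<^sup>2"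
    by (simp add: z_def q_def x_def y_def add_ac)
  have w: "w = 2 * (2 * x + 1)"
    by (simp add: w_def x_def)
  \<comment> \<open>Both sides of the WZ identity are multiples of \<open>F m n / (w * z)\<close>,
    which leaves this polynomial identity.\<close>
  have key: "w * z - c = e * z - e' * q (Suc n)"
    unfolding z w p c_def e_def e'_def by algebra
  have FSuc: "F (Suc m) n = F m n * c / (w * z)"
    by (simp add: x_def z_def w_def c_def add.commute)
  have shift: "F m (Suc n) = F m n * q (Suc n) / z"
    using F_shift[of m n] z0 by (simp add: nonzero_eq_divide_eq z_def)
  have "F m n - F (Suc m) n = F m n * (w * z - c) / (w * z)"
    unfolding FSuc using z0 w0 by (simp add: right_diff_distrib diff_divide_distrib)
  also have "\<dots> = F m n * e / w - F m n * q (Suc n) / z * e' / w"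
    unfolding key using z0 w0 by (simp add: right_diff_distrib diff_divide_distrib mult_ac)
  also have "\<dots> = G m n - G m (Suc n)"
    by (simp add: G_def shift e_def e'_def x_def y_def w_def add.commute)
  finally show ?thesis .
qed

section \<open>Growth of \<open>q\<close> and decay of \<open>F\<close>\<close>

lemma eventually_q_large:
  "eventually (\<lambda>N. (real N)\<^sup>2 + norm (a\<^sup>2 + 4 * b\<^sup>2) \<le> 3 / 2 * norm (q N)) sequentially"
proof -
  define A B D where "A = norm a" and "B = norm (b\<^sup>2)" and "D = norm (a\<^sup>2 + 4 * b\<^sup>2)"
  \<comment> \<open>The bracket bounds \<open>norm (q N)\<close> from below. Any factor above 1
    would do here; \<open>3 / 2\<close> later gives the contraction ratio
    \<open>1 / 3 * (3 / 2) = 1 / 2\<close>.\<close>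
  have "eventually (\<lambda>N::nat. (real N)\<^sup>2 + D \<le> 3 / 2 * ((real N)\<^sup>2 - A * real N - B)) sequentially"
    by real_asymp
  then show ?thesis
  proof eventually_elim
    case (elim N)
    have "norm ((of_nat N)\<^sup>2 :: complex) \<le> norm (q N) + norm (a * of_nat N + b\<^sup>2)"
      using norm_triangle_ineq[of "q N" "a * of_nat N + b\<^sup>2"] by (simp add: q_def)
    also have "norm (a * of_nat N + b\<^sup>2) \<le> A * real N + B"
      using norm_triangle_ineq[of "a * of_nat N" "b\<^sup>2"] by (simp add: A_def B_def norm_mult)
    finally have "(real N)\<^sup>2 - A * real N - B \<le> norm (q N)"
      by (simp add: norm_power)
    then show ?case using elim by (simp add: D_def)
  qed
qed

text \<open>With \<open>k = m + 1\<close> and \<open>N = n + m + 2\<close> this controls the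
  recursion of \<open>F\<close> uniformly in \<open>n\<close>; with \<open>k = N\<close> it serves
  \<open>diag\<close>.\<close>

lemma norm_square_minus_div_q_le:
  assumes large: "(real N)\<^sup>2 + norm (a\<^sup>2 + 4 * b\<^sup>2) \<le> 3 / 2 * norm (q N)"
    and "k \<le> N" "N \<ge> 1"
  shows "norm ((of_nat k)\<^sup>2 - a\<^sup>2 - 4 * b\<^sup>2) / norm (q N) \<le> 3 / 2"
proof -
  have "norm ((of_nat k)\<^sup>2 - (a\<^sup>2 + 4 * b\<^sup>2)) \<le> (real k)\<^sup>2 + norm (a\<^sup>2 + 4 * b\<^sup>2)"
    using norm_triangle_ineq4[of "(of_nat k)\<^sup>2" "a\<^sup>2 + 4 * b\<^sup>2"] by (simp add: norm_power)
  moreover have "(real k)\<^sup>2 \<le> (real N)\<^sup>2" using assms(2) by (intro power_mono) auto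
  ultimately have "norm ((of_nat k)\<^sup>2 - (a\<^sup>2 + 4 * b\<^sup>2)) \<le> 3 / 2 * norm (q N)"
    using large by linarith
  moreover have "norm (q N) > 0" using q_nonzero[of "N - 1"] assms(3) by simp
  ultimately show ?thesis by (simp add: field_simps diff_diff_add)
qed

lemma norm_F_Suc:
  "norm (F (Suc m) n) = norm (F m n) * (real (Suc m) / (2 * real (2 * m + 1)) *
     (norm ((of_nat (Suc m))\<^sup>2 - a\<^sup>2 - 4 * b\<^sup>2 :: complex) / norm (q (n + m + 2))))"
  by (simp only: F.simps norm_mult norm_divide norm_of_nat norm_numeral) simp

text \<open>The factor \<open>(m + 1) / (2 * (2 * m + 1))\<close> is 1/2 at \<open>m = 0\<close> and
  at most 1/3 afterwards; the other quotient is at most 3/2. So the ratio 1/2 requires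
  \<open>m \<ge> 1\<close>, while 3/4, weakened to 1, is available for every
  \<open>m\<close>.\<close>

lemma norm_F_Suc_le:
  assumes "(real (n + m + 2))\<^sup>2 + norm (a\<^sup>2 + 4 * b\<^sup>2) \<le> 3 / 2 * norm (q (n + m + 2))"
  shows "m \<ge> 1 \<Longrightarrow> norm (F (Suc m) n) \<le> norm (F m n) / 2"
    and "norm (F (Suc m) n) \<le> norm (F m n)"
proof -
  let ?c = "norm ((of_nat (Suc m))\<^sup>2 - a\<^sup>2 - 4 * b\<^sup>2 :: complex)"
  have c: "?c / norm (q (n + m + 2)) \<le> 3 / 2"
    using assms by (rule norm_square_minus_div_q_le) simp_all
  {
    assume "m \<ge> 1"
    then have "real (Suc m) / (2 * real (2 * m + 1)) \<le> 1 / 3" by (simp add: field_simps)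
    then have "real (Suc m) / (2 * real (2 * m + 1)) * (?c / norm (q (n + m + 2))) \<le> 1 / 3 * (3 / 2)"
      by (intro mult_mono c) auto
    then have "norm (F m n) * (real (Suc m) / (2 * real (2 * m + 1)) * (?c / norm (q (n + m + 2))))
        \<le> norm (F m n) * (1 / 2)"
      by (intro mult_left_mono) auto
    then show "norm (F (Suc m) n) \<le> norm (F m n) / 2" unfolding norm_F_Suc by simp
  }
  have "real (Suc m) / (2 * real (2 * m + 1)) \<le> 1 / 2" by (simp add: field_simps)
  then have "real (Suc m) / (2 * real (2 * m + 1)) * (?c / norm (q (n + m + 2))) \<le> 1 / 2 * (3 / 2)"
    by (intro mult_mono c) auto
  then have "norm (F m n) * (real (Suc m) / (2 * real (2 * m + 1)) * (?c / norm (q (n + m + 2))))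
      \<le> norm (F m n) * 1"
    by (intro mult_left_mono) (linarith, simp)
  then show "norm (F (Suc m) n) \<le> norm (F m n)" unfolding norm_F_Suc by simp
qed

text \<open>For large \<open>n\<close> the norm does not increase from \<open>m\<close> to
  \<open>m + 1\<close>, so the bound for \<open>m = 0\<close> persists; only the threshold for
  \<open>n\<close> depends on \<open>m\<close>.\<close>

lemma eventually_norm_F_le:
  "eventually (\<lambda>n. norm (F m n) \<le> 3 * inverse ((real (Suc n))\<^sup>2)) sequentially"
proof (induction m)
  case 0
  show ?case
    using eventually_sequentially_Suc[THEN iffD2, OF eventually_q_large]
  proof eventually_elim
    case (elim n)
    have "(real (Suc n))\<^sup>2 \<le> 3 / 2 * norm (q (Suc n))"
      using elim norm_ge_zero[of "a\<^sup>2 + 4 * b\<^sup>2"] by linarith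
    moreover have "norm (q (Suc n)) > 0" using q_nonzero by simp
    moreover have "(real (Suc n))\<^sup>2 > 0" by simp
    ultimately show ?case
      by (simp add: norm_divide field_simps del: of_nat_Suc)
  qed
next
  case (Suc m)
  show ?case
    using Suc sequentially_offset[OF eventually_q_large, of "m + 2"]
  proof eventually_elim
    case (elim n)
    have "norm (F (Suc m) n) \<le> norm (F m n)"
      using elim(2) by (intro norm_F_Suc_le(2)) (simp only: add.assoc)
    with elim(1) show ?case by linarith
  qed
qed

lemma summable_norm_F: "summable (\<lambda>n. norm (F m n))"
proof (rule summable_comparison_test_ev)
  show "eventually (\<lambda>n. norm (norm (F m n)) \<le> 3 * inverse ((real (Suc n))\<^sup>2)) sequentially"
    using eventually_norm_F_le by simp
  show "summable (\<lambda>n. 3 * inverse ((real (Suc n))\<^sup>2))"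
    by (intro summable_mult, subst summable_Suc_iff) (rule inverse_power_summable, simp)
qed

lemma summable_F: "summable (F m)"
  using summable_norm_F by (rule summable_norm_cancel)

section \<open>Telescoping over \<open>n\<close> and the limit in \<open>m\<close>\<close>

lemma G_tendsto_zero: "G m \<longlonglongrightarrow> 0"
proof -
  have F0: "F m \<longlonglongrightarrow> 0"
    using summable_F by (rule summable_LIMSEQ_zero)
  \<comment> \<open>The numerator in \<open>G\<close> is linear in \<open>n\<close>, so the decay of
    \<open>F\<close> has to beat \<open>1 / n\<close>.\<close>
  have nF0: "(\<lambda>n. F m n * of_nat n) \<longlonglongrightarrow> 0"
  proof (rule Lim_null_comparison)
    show "eventually (\<lambda>n. norm (F m n * of_nat n) \<le> 3 * inverse ((real (Suc n))\<^sup>2) * real n)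
        sequentially"
      using eventually_norm_F_le[of m]
      by eventually_elim (simp only: norm_mult norm_of_nat, intro mult_right_mono, auto)
    show "(\<lambda>n. 3 * inverse ((real (Suc n))\<^sup>2) * real n) \<longlonglongrightarrow> 0"
      by real_asymp
  qed
  have "(\<lambda>n. (F m n * (3 * of_nat (Suc m) - a) + 2 * (F m n * of_nat n)) / (2 * of_nat (2 * m + 1)))
      \<longlonglongrightarrow> (0 * (3 * of_nat (Suc m) - a) + 2 * 0) / (2 * of_nat (2 * m + 1))"
    by (intro tendsto_intros F0 nF0) (simp only: mult_eq_0_iff of_nat_eq_0_iff, simp)
  then show ?thesis
    by (simp add: G_def[abs_def] algebra_simps del: of_nat_Suc of_nat_add)
qed

lemma suminf_F_Suc: "suminf (F (Suc m)) = suminf (F m) - G m 0"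
proof -
  have "(\<lambda>n. G m n - G m (Suc n)) sums (G m 0 - 0)"
    using G_tendsto_zero by (rule telescope_sums')
  then have "(\<lambda>n. F m n - F (Suc m) n) sums G m 0"
    by (simp only: F_diff diff_0_right)
  moreover have "(\<lambda>n. F m n - F (Suc m) n) sums (suminf (F m) - suminf (F (Suc m)))"
    by (intro sums_diff summable_sums summable_F)
  ultimately show ?thesis using sums_unique2 by fastforce
qed

lemma sum_G_eq: "(\<Sum>k<m. G k 0) = suminf (F 0) - suminf (F m)"
  by (induction m) (simp_all add: suminf_F_Suc del: F.simps)

lemma suminf_F_tendsto_zero: "(\<lambda>m. suminf (F m)) \<longlonglongrightarrow> 0"
proof -
  obtain M where M: "\<And>N. N \<ge> M \<Longrightarrow> (real N)\<^sup>2 + norm (a\<^sup>2 + 4 * b\<^sup>2) \<le> 3 / 2 * norm (q N)"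
    using eventually_q_large unfolding eventually_sequentially by blast
  \<comment> \<open>Once \<open>m > M\<close>, the index \<open>n + m + 2\<close> exceeds
    \<open>M\<close> whatever \<open>n\<close> is, so the decay is uniform in \<open>n\<close>.
    Starting at \<open>Suc M\<close> also ensures \<open>m \<ge> 1\<close>.\<close>
  have half: "norm (F (Suc M + i) n) \<le> norm (F (Suc M) n) * (1 / 2) ^ i" for i n
  proof (induction i)
    case (Suc i)
    have "norm (F (Suc (Suc M + i)) n) \<le> norm (F (Suc M + i) n) / 2"
      by (rule norm_F_Suc_le(1)[OF M]) simp_all
    with Suc show ?case by (simp del: F.simps)
  qed simp
  have "norm (suminf (F (Suc M + i))) \<le> (\<Sum>n. norm (F (Suc M) n)) * (1 / 2) ^ i" for i
  proof -
    have "norm (suminf (F (Suc M + i))) \<le> (\<Sum>n. norm (F (Suc M + i) n))"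
      by (rule summable_norm) (rule summable_norm_F)
    also have "\<dots> \<le> (\<Sum>n. norm (F (Suc M) n) * (1 / 2) ^ i)"
      by (intro suminf_le half summable_norm_F summable_mult2)
    also have "\<dots> = (\<Sum>n. norm (F (Suc M) n)) * (1 / 2) ^ i"
      by (rule suminf_mult2[symmetric]) (rule summable_norm_F)
    finally show ?thesis .
  qed
  moreover have "(\<lambda>i. (\<Sum>n. norm (F (Suc M) n)) * (1 / 2) ^ i) \<longlonglongrightarrow> 0"
    by (intro tendsto_mult_right_zero LIMSEQ_power_zero) simp
  ultimately have "(\<lambda>i. suminf (F (Suc M + i))) \<longlonglongrightarrow> 0"
    by (rule Lim_null_comparison[OF always_eventually, OF allI])
  then have "(\<lambda>i. suminf (F (i + Suc M))) \<longlonglongrightarrow> 0"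
    by (simp only: add.commute)
  then show ?thesis by (rule LIMSEQ_offset)
qed

lemma sums_G: "(\<lambda>k. G k 0) sums (\<Sum>n. F 0 n)"
proof -
  have "(\<lambda>m. suminf (F 0) - suminf (F m)) \<longlonglongrightarrow> suminf (F 0) - 0"
    by (intro tendsto_diff tendsto_const suminf_F_tendsto_zero)
  then show ?thesis by (simp add: sums_def sum_G_eq del: F.simps)
qed

section \<open>Entries of the partial products\<close>

lemma F_zero: "F m 0 = (\<Prod>k=1..m. diag k) * (2 * of_nat (2 * m + 1)) / q (Suc m)"
proof (induction m)
  case (Suc m)
  define u v where "u = (of_nat (2 * m + 1) :: complex)" and "v = (of_nat (2 * Suc m + 1) :: complex)"
  have nz: "u \<noteq> 0" "v \<noteq> 0" by (simp_all only: u_def v_def of_nat_eq_0_iff)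
  have d: "diag (Suc m) = of_nat (Suc m) / (2 * v) * (((of_nat (Suc m))\<^sup>2 - a\<^sup>2 - 4 * b\<^sup>2) / q (Suc m))"
    by (simp only: diag_def v_def of_nat_mult of_nat_add of_nat_numeral of_nat_1)
  \<comment> \<open>The recursion divides by \<open>2 * u * q (m + 2)\<close>, but
    \<open>diag (m + 1)\<close> by \<open>2 * v * q (m + 1)\<close>; the trailing factor in the
    claim compensates for this shift.\<close>
  have "F (Suc m) 0 = (\<Prod>k=1..m. diag k) * (2 * u) / q (Suc m)
      * (of_nat (Suc m) * ((of_nat (Suc m))\<^sup>2 - a\<^sup>2 - 4 * b\<^sup>2)) / (2 * u * q (Suc (Suc m)))"
    by (simp only: F.simps Suc u_def) simp
  also have "\<dots> = (\<Prod>k=1..m. diag k) * diag (Suc m) * (2 * v) / q (Suc (Suc m))"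
    unfolding d using nz by simp
  also have "\<dots> = (\<Prod>k=1..Suc m. diag k) * (2 * v) / q (Suc (Suc m))"
    by simp
  finally show ?case by (simp only: v_def)
qed simp

lemma G_zero: "G m 0 = (\<Prod>k=1..m. diag k) * ((3 * of_nat (Suc m) - a) / q (Suc m))"
proof -
  have "of_nat (2 * m + 1) \<noteq> (0::complex)" by (simp only: of_nat_eq_0_iff)
  then show ?thesis by (simp add: G_def F_zero del: of_nat_Suc of_nat_add)
qed

text \<open>The two factors of \<open>diag k\<close> tend to 1/4 and 1, so eventually the norm is at
  most \<open>1 / 4 * (3 / 2) = 3 / 8\<close>.\<close>

lemma prod_diag_tendsto_zero: "(\<lambda>m. \<Prod>k=1..m. diag k) \<longlonglongrightarrow> 0"
proof -
  obtain M where M: "\<And>N. N \<ge> M \<Longrightarrow> (real N)\<^sup>2 + norm (a\<^sup>2 + 4 * b\<^sup>2) \<le> 3 / 2 * norm (q N)"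
    using eventually_q_large unfolding eventually_sequentially by blast
  have diag_le: "norm (diag (Suc k)) \<le> 3 / 8" if "k \<ge> M" for k
  proof -
    have c: "norm (((of_nat (Suc k))\<^sup>2 - a\<^sup>2 - 4 * b\<^sup>2) / q (Suc k)) \<le> 3 / 2"
      unfolding norm_divide using M[OF le_SucI[OF that]]
      by (rule norm_square_minus_div_q_le) simp_all
    have "norm (of_nat (Suc k) / (2 * (2 * of_nat (Suc k) + 1)) :: complex)
        = norm (of_nat (Suc k) / of_nat (2 * (2 * Suc k + 1)) :: complex)"
      by (simp only: of_nat_mult of_nat_add of_nat_numeral of_nat_1)
    also have "\<dots> = real (Suc k) / real (2 * (2 * Suc k + 1))"
      by (simp only: norm_divide norm_of_nat)
    also have "\<dots> \<le> 1 / 4" by (simp add: field_simps)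
    finally have "norm (of_nat (Suc k) / (2 * (2 * of_nat (Suc k) + 1)) :: complex) \<le> 1 / 4" .
    then have "norm (diag (Suc k)) \<le> 1 / 4 * (3 / 2)"
      unfolding diag_def norm_mult using c by (intro mult_mono) auto
    then show ?thesis by simp
  qed
  have "summable (\<lambda>m. \<Prod>k=1..m. diag k)"
  proof (rule summable_ratio_test[of "3 / 8" M])
    fix m assume "m \<ge> M"
    then show "norm (\<Prod>k=1..Suc m. diag k) \<le> 3 / 8 * norm (\<Prod>k=1..m. diag k)"
      using mult_left_mono[OF diag_le, of m "norm (\<Prod>k=1..m. diag k)"]
      by (simp add: norm_mult mult.commute)
  qed simp
  then show ?thesis by (rule summable_LIMSEQ_zero)
qed

text \<open>Right multiplication by a factor with top row \<open>(d, t)\<close> turns the top row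
  \<open>(P, S)\<close> into \<open>(P * d, P * t + S)\<close>, and \<open>P * t\<close> is
  \<open>G m 0\<close> by \<open>G_zero\<close>.\<close>

lemma matrix_partial_prod_eq:
  "matrix_partial_prod (\<lambda>k. vector [vector [diag k, (3 * of_nat k - a) / q k], vector [0, 1]]
     :: complex ^ 2 ^ 2) m
   = vector [vector [\<Prod>k=1..m. diag k, \<Sum>k<m. G k 0], vector [0, 1]]"
proof (induction m)
  case 0
  show ?case by (simp add: vec_eq_iff forall_2 mat_def)
next
  case (Suc m)
  show ?case
    by (simp add: Suc vec_eq_iff forall_2 matrix_matrix_mult_def sum_2 G_zero del: of_nat_Suc)
qed

lemma has_matrix_prod_F:
  "(\<lambda>k. vector [vector [diag k, (3 * of_nat k - a) / q k], vector [0, 1]] :: complex ^ 2 ^ 2)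
     has_matrix_prod vector [vector [0, \<Sum>n. F 0 n], vector [0, 1]]"
  unfolding has_matrix_prod_def matrix_partial_prod_eq
  using prod_diag_tendsto_zero sums_G by (simp add: forall_2 sums_def del: F.simps)

section \<open>Evaluation by digamma values\<close>

lemma suminf_F_zero_Digamma:
  assumes D: "a\<^sup>2 + 4 * b\<^sup>2 \<noteq> 0" and s: "s\<^sup>2 = a\<^sup>2 + 4 * b\<^sup>2"
  shows "(\<Sum>n. F 0 n) = 2 / s * (Digamma (1 - a / 2 + s / 2) - Digamma (1 - a / 2 - s / 2))"
proof -
  define u v where "u = 1 - a / 2 + s / 2" and "v = 1 - a / 2 - s / 2"
  have s0: "s \<noteq> 0" using D s by auto
  \<comment> \<open>Difference of squares: \<open>q x = (x - a / 2)\<^sup>2 - s\<^sup>2 / 4\<close>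
    at \<open>x = n + 1\<close>.\<close>
  have q: "q (Suc n) = (u + of_nat n) * (v + of_nat n)" for n
  proof -
    have "4 * q (Suc n) = 4 * ((u + of_nat n) * (v + of_nat n))"
      using s unfolding q_def u_def v_def by (simp add: field_simps power2_eq_square) algebra
    then show ?thesis by simp
  qed
  \<comment> \<open>Hence neither \<open>u\<close> nor \<open>v\<close> is a pole of the digamma
    function.\<close>
  have nz: "u + of_nat n \<noteq> 0" "v + of_nat n \<noteq> 0" for n
    using q_nonzero[of n] unfolding q by auto
  have sums: "(\<lambda>n. inverse (of_nat (Suc n)) - inverse (z + of_nat n)) sums (Digamma z + euler_mascheroni)"
    if "z \<noteq> 0" for z :: complex
    using summable_Digamma[OF that] by (simp add: Digamma_def summable_sums)
  \<comment> \<open>Subtraction cancels the harmonic terms and Euler's constant. Since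
    \<open>u - v = s\<close>, what remains is the partial fraction form of
    \<open>s / q (n + 1)\<close>.\<close>
  have "(\<lambda>n. (inverse (of_nat (Suc n)) - inverse (u + of_nat n))
      - (inverse (of_nat (Suc n)) - inverse (v + of_nat n)))
      sums ((Digamma u + euler_mascheroni) - (Digamma v + euler_mascheroni))"
    using nz[of 0] by (intro sums_diff sums) auto
  then have "(\<lambda>n. 2 / s * (inverse (v + of_nat n) - inverse (u + of_nat n)))
      sums (2 / s * (Digamma u - Digamma v))"
    by (intro sums_mult) simp
  moreover have "2 / s * (inverse (v + of_nat n) - inverse (u + of_nat n)) = F 0 n" for n
  proof -
    have "u = v + s" by (simp add: u_def v_def)
    then show ?thesis using nz[of n] s0 unfolding F.simps q
      by (simp add: divide_simps)
  qed
  ultimately show ?thesis by (simp add: sums_iff u_def v_def del: F.simps)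
qed

end

theorem theorem7p2:
  fixes a b :: complex
  assumes nz: "\<And>n::nat. n \<ge> 1 \<Longrightarrow> (of_nat n)\<^sup>2 - a * of_nat n - b\<^sup>2 \<noteq> 0"
  shows "summable (\<lambda>n. 2 / ((of_nat (Suc n))\<^sup>2 - a * of_nat (Suc n) - b\<^sup>2)) \<and>
    (\<lambda>k. vector [
        vector [of_nat k / (2 * (2 * of_nat k + 1)) *
                  (((of_nat k)\<^sup>2 - a\<^sup>2 - 4 * b\<^sup>2) / ((of_nat k)\<^sup>2 - a * of_nat k - b\<^sup>2)),
                (3 * of_nat k - a) / ((of_nat k)\<^sup>2 - a * of_nat k - b\<^sup>2)],
        vector [0, 1]] :: complex ^ 2 ^ 2)
      has_matrix_prod
    vector [
        vector [0, \<Sum>n. 2 / ((of_nat (Suc n))\<^sup>2 - a * of_nat (Suc n) - b\<^sup>2)],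
        vector [0, 1]] \<and>
    (a\<^sup>2 + 4 * b\<^sup>2 \<noteq> 0 \<longrightarrow>
      (\<forall>s. s\<^sup>2 = a\<^sup>2 + 4 * b\<^sup>2 \<longrightarrow>
        (\<Sum>n. 2 / ((of_nat (Suc n))\<^sup>2 - a * of_nat (Suc n) - b\<^sup>2)) =
          2 / s * (Digamma (1 - a / 2 + s / 2) - Digamma (1 - a / 2 - s / 2))))"
proof -
  interpret matrix_wz a b by unfold_locales (rule nz)
  show ?thesis
    \<comment> \<open>\<open>F 0 n\<close> is the series term of index \<open>n + 1\<close>,
      matching \<open>Suc n\<close> in the statement.\<close>
    using summable_F[of 0] has_matrix_prod_F suminf_F_zero_Digamma
    unfolding F.simps diag_def q_def by (intro conjI impI allI)
qed

end
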